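(* Let $U_5=\{L(\alpha)\in CE(\mu_8): b_{1,6}=0,\ b_{1,4}\neq0,\ b_{1,1}\neq0\}$, and for $\alpha=(b_{0,0},b_{0,1},b_{1,1},b_{1,2},b_{1,4},b_{1,6})$ and $\alpha'=(b_{0,0}',b_{0,1}',b_{1,1}',b_{1,2}',b_{1,4}',b_{1,6}')$ put $\Delta=b_{0,1}^2-4b_{0,0}b_{1,1}$ and $\Delta'=b_{0,1}'^2-4b_{0,0}'b_{1,1}'$. (1) Two algebras $L(\alpha)$ and $L(\alpha')$ from $U_5$ are isomorphic if and only if $$\left(\frac{b_{1,1}}{b_{1,4}}\right)^{4}\frac{1}{\Delta}=\left(\frac{b_{1,1}'}{b_{1,4}'}\right)^{4}\frac{1}{\Delta'}.$$ (2) For any $\lambda\in\mathbb{C}$ there exists $L(b_{0,0},b_{0,1},b_{1,1},b_{1,2},b_{1,4},b_{1,6})\in U_5$ such that $$\left(\frac{b_{1,1}}{b_{1,4}}\right)^{4}\frac{1}{\Delta}=\lambda.$$ Then the algebras from the set $U_5$ can be parameterized as $L(\lambda,0,1,0,1,0)$, $\lambda\in\mathbb{C}$.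
   Context: A Leibniz algebra over $\mathbb{C}$ is a complex vector space with a bilinear bracket satisfying $[x,[y,z]]=[[x,y],z]-[[x,z],y]$. $CE(\mu_8)$ (one-dimensional Leibniz central extensions of the 8-dimensional naturally graded filiform Lie algebra $\mu_8$) is the class of the 9-dimensional complex Leibniz algebras $L(\alpha)$, $\alpha=(b_{0,0},b_{0,1},b_{1,1},b_{1,2},b_{1,4},b_{1,6})\in\mathbb{C}^6$, with basis $e_0,\dots,e_8$ and brackets $[e_i,e_0]=e_{i+1}$ ($1\le i\le 7$), $[e_0,e_i]=-e_{i+1}$ ($2\le i\le 7$), $[e_0,e_0]=b_{0,0}e_8$, $[e_0,e_1]=-e_2+b_{0,1}e_8$, $[e_1,e_1]=b_{1,1}e_8$, $[e_1,e_2]=-[e_2,e_1]=b_{1,2}e_8$, $[e_1,e_4]=-[e_4,e_1]=b_{1,4}e_8$, $[e_2,e_3]=-[e_3,e_2]=-b_{1,4}e_8$, $[e_1,e_6]=-[e_6,e_1]=b_{1,6}e_8$, $[e_2,e_5]=-[e_5,e_2]=-b_{1,6}e_8$, $[e_3,e_4]=-[e_4,e_3]=b_{1,6}e_8$, all other brackets of basis vectors being zero. Isomorphic means isomorphic as Leibniz algebras.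
   Formalization: Since Δ may vanish on U_5 (e.g. for L(0,0,1,0,1,0)), where 1/Δ is undefined, and (2) would fail for λ=0, the expression 1/Δ is read as 0 when Δ=0; all of U_5 and all λ remain covered. *)

theory Defs
  imports "HOL-Analysis.Analysis"
begin

text \<open>(Right) Leibniz algebras over \<open>\<complex>\<close>, with carrier a whole type.\<close>

locale leibniz_algebra = vector_space scale
  for scale :: "complex \<Rightarrow> 'a::ab_group_add \<Rightarrow> 'a" +
  fixes bracket :: "'a \<Rightarrow> 'a \<Rightarrow> 'a"
  assumes bracket_linear_left: "Vector_Spaces.linear scale scale (\<lambda>x. bracket x y)"
    and bracket_linear_right: "Vector_Spaces.linear scale scale (\<lambda>y. bracket x y)"
    and leibniz_identity:
      "bracket x (bracket y z) = bracket (bracket x y) z - bracket (bracket x z) y"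

definition leibniz_isomorphic ::
  "(complex \<Rightarrow> 'a::ab_group_add \<Rightarrow> 'a) \<Rightarrow> ('a \<Rightarrow> 'a \<Rightarrow> 'a) \<Rightarrow>
   (complex \<Rightarrow> 'b::ab_group_add \<Rightarrow> 'b) \<Rightarrow> ('b \<Rightarrow> 'b \<Rightarrow> 'b) \<Rightarrow> bool" where
  "leibniz_isomorphic scale1 bracket1 scale2 bracket2 \<longleftrightarrow>
     (\<exists>f. Vector_Spaces.linear scale1 scale2 f \<and> bij f \<and>
          (\<forall>x y. f (bracket1 x y) = bracket2 (f x) (f y)))"

datatype ce_param =
  CE_param (b00: complex) (b01: complex) (b11: complex) (b12: complex) (b14: complex) (b16: complex)

text \<open>
  The underlying vector space of every algebra in the family is \<open>\<complex>\<^sup>9\<close>. The numeral type 9 has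
  the elements \<open>0, \<dots>, 8\<close> with arithmetic modulo 9, so the basis is indexed by natural numbers
  (only indices below 9 are used) to avoid wrap-around in \<open>i + 1\<close>.
\<close>

definition e :: "nat \<Rightarrow> complex ^ 9" where
  "e i = axis (of_nat i) 1"

definition basis_bracket :: "ce_param \<Rightarrow> nat \<Rightarrow> nat \<Rightarrow> complex ^ 9" where
  "basis_bracket \<alpha> i j =
     (if 1 \<le> i \<and> i \<le> 7 \<and> j = 0 then e (i + 1)
      else if i = 0 \<and> 2 \<le> j \<and> j \<le> 7 then - e (j + 1)
      else if (i, j) = (0, 0) then b00 \<alpha> *s e 8
      else if (i, j) = (0, 1) then - e 2 + b01 \<alpha> *s e 8
      else if (i, j) = (1, 1) then b11 \<alpha> *s e 8
      else if (i, j) = (1, 2) then b12 \<alpha> *s e 8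
      else if (i, j) = (2, 1) then - b12 \<alpha> *s e 8
      else if (i, j) = (1, 4) then b14 \<alpha> *s e 8
      else if (i, j) = (4, 1) then - b14 \<alpha> *s e 8
      else if (i, j) = (2, 3) then - b14 \<alpha> *s e 8
      else if (i, j) = (3, 2) then b14 \<alpha> *s e 8
      else if (i, j) = (1, 6) then b16 \<alpha> *s e 8
      else if (i, j) = (6, 1) then - b16 \<alpha> *s e 8
      else if (i, j) = (2, 5) then - b16 \<alpha> *s e 8
      else if (i, j) = (5, 2) then b16 \<alpha> *s e 8
      else if (i, j) = (3, 4) then b16 \<alpha> *s e 8
      else if (i, j) = (4, 3) then - b16 \<alpha> *s e 8
      else 0)"

definition L :: "ce_param \<Rightarrow> complex ^ 9 \<Rightarrow> complex ^ 9 \<Rightarrow> complex ^ 9" where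
  "L \<alpha> x y = (\<Sum>i<9. \<Sum>j<9. (x $ of_nat i * y $ of_nat j) *s basis_bracket \<alpha> i j)"

lemma of_nat_9_eq_iff: "i < 9 \<Longrightarrow> j < 9 \<Longrightarrow> (of_nat i :: 9) = of_nat j \<longleftrightarrow> i = j"
proof -
  assume ij: "i < 9" "j < 9"
  have *: "k < 9 \<Longrightarrow> Rep_bit1 (of_nat k :: 9) = int k" for k
    by (simp add: bit1.of_nat_eq Abs_bit1_inverse)
  show ?thesis
    using *[OF ij(1)] *[OF ij(2)] by (metis of_nat_eq_iff)
qed

lemma UNIV_9: "(UNIV :: 9 set) = {0, 1, 2, 3, 4, 5, 6, 7, 8}"
proof -
  have "inj_on (of_nat :: nat \<Rightarrow> 9) {..<9}"
    by (auto simp: inj_on_def of_nat_9_eq_iff)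
  then have "card ((of_nat :: nat \<Rightarrow> 9) ` {..<9}) = CARD(9)"
    by (simp add: card_image)
  then have "(of_nat :: nat \<Rightarrow> 9) ` {..<9} = UNIV"
    by (metis card_subset_eq finite subset_UNIV)
  moreover have "{..<9::nat} = {0, 1, 2, 3, 4, 5, 6, 7, 8}"
    by auto
  ultimately show ?thesis
    by simp
qed

lemma L_basis:
  assumes "i < 9" "j < 9"
  shows "L \<alpha> (e i) (e j) = basis_bracket \<alpha> i j"
proof -
  have e_nth: "e i $ of_nat k = (if k = i then 1 else 0)" if "i < 9" "k < 9" for i k
    using that by (auto simp: e_def axis_def of_nat_9_eq_iff)
  have "L \<alpha> (e i) (e j) =
      (\<Sum>k<9. \<Sum>l<9. if l = j then (if k = i then basis_bracket \<alpha> k l else 0) else 0)"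
    unfolding L_def using assms by (intro sum.cong) (auto simp: e_nth)
  also have "\<dots> = basis_bracket \<alpha> i j"
    using assms by (simp add: sum.delta)
  finally show ?thesis .
qed

lemma L_nth:
  "L \<alpha> x y $ 0 = 0"
  "L \<alpha> x y $ 1 = 0"
  "L \<alpha> x y $ 2 = x $ 1 * y $ 0 - x $ 0 * y $ 1"
  "L \<alpha> x y $ 3 = x $ 2 * y $ 0 - x $ 0 * y $ 2"
  "L \<alpha> x y $ 4 = x $ 3 * y $ 0 - x $ 0 * y $ 3"
  "L \<alpha> x y $ 5 = x $ 4 * y $ 0 - x $ 0 * y $ 4"
  "L \<alpha> x y $ 6 = x $ 5 * y $ 0 - x $ 0 * y $ 5"
  "L \<alpha> x y $ 7 = x $ 6 * y $ 0 - x $ 0 * y $ 6"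
  "L \<alpha> x y $ 8 = x $ 7 * y $ 0 - x $ 0 * y $ 7
     + b00 \<alpha> * x $ 0 * y $ 0 + b01 \<alpha> * x $ 0 * y $ 1 + b11 \<alpha> * x $ 1 * y $ 1
     + b12 \<alpha> * (x $ 1 * y $ 2 - x $ 2 * y $ 1)
     + b14 \<alpha> * (x $ 1 * y $ 4 - x $ 4 * y $ 1 - x $ 2 * y $ 3 + x $ 3 * y $ 2)
     + b16 \<alpha> * (x $ 1 * y $ 6 - x $ 6 * y $ 1 - x $ 2 * y $ 5 + x $ 5 * y $ 2
                 + x $ 3 * y $ 4 - x $ 4 * y $ 3)"
proof -
  have nat9: "{..<9::nat} = {0, 1, 2, 3, 4, 5, 6, 7, 8}"
    by auto
  have e_nth: "e i $ of_nat k = (if k = i then 1 else 0)" if "i < 9" "k < 9" for i k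
    using that by (auto simp: e_def axis_def of_nat_9_eq_iff)
  have L_nth: "L \<alpha> x y $ of_nat k =
      (\<Sum>i<9. \<Sum>j<9. x $ of_nat i * y $ of_nat j * basis_bracket \<alpha> i j $ of_nat k)" for k
    by (simp add: L_def)
  note e_nths = e_nth[of _ 0, simplified] e_nth[of _ 1, simplified] e_nth[of _ 2, simplified]
    e_nth[of _ 3, simplified] e_nth[of _ 4, simplified] e_nth[of _ 5, simplified]
    e_nth[of _ 6, simplified] e_nth[of _ 7, simplified] e_nth[of _ 8, simplified]
  note unf = nat9 basis_bracket_def e_nths algebra_simps
  show "L \<alpha> x y $ 0 = 0" using L_nth[of 0] by (simp add: unf)
  show "L \<alpha> x y $ 1 = 0" using L_nth[of 1] by (simp add: unf)
  show "L \<alpha> x y $ 2 = x $ 1 * y $ 0 - x $ 0 * y $ 1" using L_nth[of 2] by (simp add: unf)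
  show "L \<alpha> x y $ 3 = x $ 2 * y $ 0 - x $ 0 * y $ 2" using L_nth[of 3] by (simp add: unf)
  show "L \<alpha> x y $ 4 = x $ 3 * y $ 0 - x $ 0 * y $ 3" using L_nth[of 4] by (simp add: unf)
  show "L \<alpha> x y $ 5 = x $ 4 * y $ 0 - x $ 0 * y $ 4" using L_nth[of 5] by (simp add: unf)
  show "L \<alpha> x y $ 6 = x $ 5 * y $ 0 - x $ 0 * y $ 5" using L_nth[of 6] by (simp add: unf)
  show "L \<alpha> x y $ 7 = x $ 6 * y $ 0 - x $ 0 * y $ 6" using L_nth[of 7] by (simp add: unf)
  show "L \<alpha> x y $ 8 = x $ 7 * y $ 0 - x $ 0 * y $ 7
     + b00 \<alpha> * x $ 0 * y $ 0 + b01 \<alpha> * x $ 0 * y $ 1 + b11 \<alpha> * x $ 1 * y $ 1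
     + b12 \<alpha> * (x $ 1 * y $ 2 - x $ 2 * y $ 1)
     + b14 \<alpha> * (x $ 1 * y $ 4 - x $ 4 * y $ 1 - x $ 2 * y $ 3 + x $ 3 * y $ 2)
     + b16 \<alpha> * (x $ 1 * y $ 6 - x $ 6 * y $ 1 - x $ 2 * y $ 5 + x $ 5 * y $ 2
                 + x $ 3 * y $ 4 - x $ 4 * y $ 3)"
    using L_nth[of 8] by (simp add: unf)
qed

lemma leibniz_algebra_L: "leibniz_algebra (*s) (L \<alpha>)"
proof -
  have all_9: "(\<forall>k::9. P k) \<longleftrightarrow> P 0 \<and> P 1 \<and> P 2 \<and> P 3 \<and> P 4 \<and> P 5 \<and> P 6 \<and> P 7 \<and> P 8" for P
    using UNIV_9 by (metis (full_types) UNIV_I insertE empty_iff)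
  show ?thesis
  proof unfold_locales
    fix x y z :: "complex ^ 9" and c :: complex
    show "L \<alpha> (x + y) z = L \<alpha> x z + L \<alpha> y z" "L \<alpha> z (x + y) = L \<alpha> z x + L \<alpha> z y"
      "L \<alpha> (c *s x) z = c *s L \<alpha> x z" "L \<alpha> z (c *s x) = c *s L \<alpha> z x"
      by (simp_all add: vec_eq_iff all_9 L_nth algebra_simps)
    show "L \<alpha> x (L \<alpha> y z) = L \<alpha> (L \<alpha> x y) z - L \<alpha> (L \<alpha> x z) y"
      by (simp add: vec_eq_iff all_9 L_nth algebra_simps)
  qed
qed

abbreviation isomorphic_L ::
  "(complex ^ 9 \<Rightarrow> complex ^ 9 \<Rightarrow> complex ^ 9) \<Rightarrow> (complex ^ 9 \<Rightarrow> complex ^ 9 \<Rightarrow> complex ^ 9) \<Rightarrow> bool"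
  (infix "\<cong>\<^sub>L" 50) where
  "A \<cong>\<^sub>L B \<equiv> leibniz_isomorphic (*s) A (*s) B"

definition U5 :: "(complex ^ 9 \<Rightarrow> complex ^ 9 \<Rightarrow> complex ^ 9) set" where
  "U5 = {L \<alpha> | \<alpha>. b16 \<alpha> = 0 \<and> b14 \<alpha> \<noteq> 0 \<and> b11 \<alpha> \<noteq> 0}"

text \<open>
  Membership in \<open>U5\<close> depends only on the parameters, since \<open>\<alpha> \<mapsto> L \<alpha>\<close> is injective.
\<close>

lemma inj_L: "inj L"
proof (rule injI)
  fix \<alpha> \<beta> assume "L \<alpha> = L \<beta>"
  then have *: "basis_bracket \<alpha> i j $ 8 = basis_bracket \<beta> i j $ 8" if "i < 9" "j < 9" for i j
    using L_basis[OF that] by metis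
  have "e 8 $ 8 = 1"
    by (simp add: e_def)
  then show "\<alpha> = \<beta>"
    using *[of 0 0] *[of 0 1] *[of 1 1] *[of 1 2] *[of 1 4] *[of 1 6]
    by (intro ce_param.expand) (simp add: basis_bracket_def)
qed

lemma L_in_U5_iff: "L \<alpha> \<in> U5 \<longleftrightarrow> b16 \<alpha> = 0 \<and> b14 \<alpha> \<noteq> 0 \<and> b11 \<alpha> \<noteq> 0"
  using inj_L by (auto simp: U5_def inj_eq)

text \<open>
  The discriminant may vanish on \<open>U5\<close>. The expression \<open>1 / disc \<alpha>\<close> is then 0 by the usual
  convention for division, so the invariant \<open>(b11 \<alpha> / b14 \<alpha>) ^ 4 * (1 / disc \<alpha>)\<close> takes the
  value 0 exactly on the algebras with \<open>disc \<alpha> = 0\<close>. In particular, two such values agree iff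
  \<open>(b11 \<alpha> / b14 \<alpha>) ^ 4 * disc \<alpha>' = (b11 \<alpha>' / b14 \<alpha>') ^ 4 * disc \<alpha>\<close>.
\<close>

definition disc :: "ce_param \<Rightarrow> complex" where
  "disc \<alpha> = (b01 \<alpha>)\<^sup>2 - 4 * b00 \<alpha> * b11 \<alpha>"

end

theory Submission
  imports Defs
begin

text \<open>
  An isomorphism \<open>L \<alpha> \<rightarrow> L \<alpha>'\<close> is determined by the images of the generators \<open>e 0\<close>, \<open>e 1\<close>.
  Since it respects the lower central series and the centralizer of its second term modulo the
  fourth, these have the form \<open>a\<^sub>0 e\<^sub>0 + a\<^sub>1 e\<^sub>1 + \<dots>\<close> and \<open>b\<^sub>1 e\<^sub>1 + b\<^sub>2 e\<^sub>2 + \<dots>\<close> with \<open>a\<^sub>0 b\<^sub>1 \<noteq> 0\<close>,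
  and \<open>e 8\<close> is scaled by \<open>a\<^sub>0\<^sup>7 b\<^sub>1\<close>. Comparing \<open>e 8\<close>-coefficients shows that \<open>b11 / b14\<close> is
  multiplied by \<open>a\<^sub>0\<^sup>3\<close> and the discriminant by \<open>a\<^sub>0 ^ 12\<close>. Conversely, \<open>a\<^sub>0\<close> is found as a cube root,
  \<open>a\<^sub>1\<close> matches \<open>b01\<close>, the coefficient of \<open>e 3\<close> in the image of \<open>e 1\<close> matches \<open>b12\<close>, and equality
  of the invariants takes care of \<open>b00\<close>.
\<close>

lemma all_9: "(\<forall>k::9. P k) \<longleftrightarrow> P 0 \<and> P 1 \<and> P 2 \<and> P 3 \<and> P 4 \<and> P 5 \<and> P 6 \<and> P 7 \<and> P 8"
  using UNIV_9 by (metis (full_types) UNIV_I insertE empty_iff)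

lemma e_expansion: "x = (\<Sum>i<9. x $ of_nat i *s e i)"
proof -
  have nat9: "{..<9::nat} = {0, 1, 2, 3, 4, 5, 6, 7, 8}"
    by auto
  have "e i $ of_nat k = (if k = i then 1 else 0)" if "i < 9" "k < 9" for i k
    using that by (auto simp: e_def axis_def of_nat_9_eq_iff)
  note e_nths = this[of _ 0, simplified] this[of _ 1, simplified] this[of _ 2, simplified]
    this[of _ 3, simplified] this[of _ 4, simplified] this[of _ 5, simplified]
    this[of _ 6, simplified] this[of _ 7, simplified] this[of _ 8, simplified]
  show ?thesis
    by (simp add: vec_eq_iff all_9 nat9 e_nths)
qed

lemma L_isomorphic_imp_parameter_equations:
  assumes "L \<alpha> \<cong>\<^sub>L L \<alpha>'" and b16: "b16 \<alpha>' = 0"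
  obtains a0 a1 b1 where "a0 \<noteq> 0" "b1 \<noteq> 0"
    "b00 \<alpha> * (a0 ^ 7 * b1) = b00 \<alpha>' * a0\<^sup>2 + b01 \<alpha>' * a0 * a1 + b11 \<alpha>' * a1\<^sup>2"
    "b01 \<alpha> * (a0 ^ 7 * b1) = b01 \<alpha>' * a0 * b1 + 2 * b11 \<alpha>' * a1 * b1"
    "b11 \<alpha> * (a0 ^ 7 * b1) = b11 \<alpha>' * b1\<^sup>2"
    "b14 \<alpha> * (a0 ^ 7 * b1) = b14 \<alpha>' * a0 ^ 3 * b1\<^sup>2"
proof -
  note One_nat_def [simp del]
  obtain f where lin: "Vector_Spaces.linear (*s) (*s) f" and "bij f"
    and hom: "\<And>x y. f (L \<alpha> x y) = L \<alpha>' (f x) (f y)"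
    using assms(1) unfolding leibniz_isomorphic_def by blast
  interpret f: Vector_Spaces.linear "(*s)" "(*s)" f
    by (rule lin)
  define w where "w i = f (e i)" for i
  have hom_basis: "f (basis_bracket \<alpha> i j) = L \<alpha>' (w i) (w j)" if "i < 9" "j < 9" for i j
    using hom[of "e i" "e j"] that by (simp add: L_basis w_def)
  have succ: "w (i + 1) = L \<alpha>' (w i) (w 0)" if "1 \<le> i" "i \<le> 7" for i
    using hom_basis[of i 0] that by (simp add: basis_bracket_def w_def)
  have w2: "w 2 = L \<alpha>' (w 1) (w 0)" and w3: "w 3 = L \<alpha>' (w 2) (w 0)"
    and w4: "w 4 = L \<alpha>' (w 3) (w 0)" and w5: "w 5 = L \<alpha>' (w 4) (w 0)"
    and w6: "w 6 = L \<alpha>' (w 5) (w 0)" and w7: "w 7 = L \<alpha>' (w 6) (w 0)"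
    and w8: "w 8 = L \<alpha>' (w 7) (w 0)"
    using succ[of 1] succ[of 2] succ[of 3] succ[of 4] succ[of 5] succ[of 6] succ[of 7]
    by simp_all
  note w_unfold = w2 w3 w4 w5 w6 w7 w8
  have h00: "b00 \<alpha> *s w 8 = L \<alpha>' (w 0) (w 0)"
    using hom_basis[of 0 0] by (simp add: basis_bracket_def w_def f.scale)
  have h01: "- w 2 + b01 \<alpha> *s w 8 = L \<alpha>' (w 0) (w 1)"
    using hom_basis[of 0 1] by (simp add: basis_bracket_def w_def f.scale f.add f.neg f.diff)
  have h11: "b11 \<alpha> *s w 8 = L \<alpha>' (w 1) (w 1)"
    using hom_basis[of 1 1] by (simp add: basis_bracket_def w_def f.scale)
  have h12: "b12 \<alpha> *s w 8 = L \<alpha>' (w 1) (w 2)"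
    using hom_basis[of 1 2] by (simp add: basis_bracket_def w_def f.scale)
  have h14: "b14 \<alpha> *s w 8 = L \<alpha>' (w 1) (w 4)"
    using hom_basis[of 1 4] by (simp add: basis_bracket_def w_def f.scale)
  define a0 a1 c0 b1 where "a0 = w 0 $ 0" "a1 = w 0 $ 1" "c0 = w 1 $ 0" "b1 = w 1 $ 1"
  note defs = this
  have nat9: "{..<9::nat} = {0, 1, 2, 3, 4, 5, 6, 7, 8}"
    by auto
  \<comment> \<open>Every \<open>w i\<close> with \<open>i\<close> at least 2 is a bracket, so its
    coordinates 0 and 1 vanish and only \<open>w 0\<close> and \<open>w 1\<close>
    contribute.\<close>
  have f_nth: "f x $ 0 = x $ 0 * a0 + x $ 1 * c0" "f x $ 1 = x $ 0 * a1 + x $ 1 * b1" for x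
  proof -
    have "f x = (\<Sum>i<9. x $ of_nat i *s w i)"
      by (subst e_expansion[of x]) (simp only: f.sum f.scale w_def)
    then show "f x $ 0 = x $ 0 * a0 + x $ 1 * c0" "f x $ 1 = x $ 0 * a1 + x $ 1 * b1"
      unfolding nat9 by (simp_all add: w_unfold L_nth defs)
  qed
  \<comment> \<open>Surjectivity makes the 2x2 matrix of \<open>f\<close> modulo the span of
    \<open>e 2\<close>, ..., \<open>e 8\<close> invertible: preimages of \<open>e 0\<close> and
    \<open>e 1\<close> supply a second determinant, and the product of the two is 1.\<close>
  obtain x y where "f x = e 0" "f y = e 1"
    using \<open>bij f\<close> by (metis bij_pointE)
  then have "x $ 0 * a0 + x $ 1 * c0 = 1" "x $ 0 * a1 + x $ 1 * b1 = 0"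
    "y $ 0 * a0 + y $ 1 * c0 = 0" "y $ 0 * a1 + y $ 1 * b1 = 1"
    using f_nth[of x] f_nth[of y] by (simp_all add: e_def axis_def)
  then have "(x $ 0 * y $ 1 - x $ 1 * y $ 0) * (a0 * b1 - a1 * c0) = 1"
    by algebra
  then have "a0 * b1 - a1 * c0 \<noteq> 0"
    by (metis mult_zero_right zero_neq_one)
  then have det: "b1 * a0 - c0 * a1 \<noteq> 0"
    by (simp add: mult.commute)
  \<comment> \<open>Coordinate 3 of \<open>w 8\<close> is zero, while that of
    \<open>[w 1, w 2]\<close> is \<open>- c0\<close> times the determinant.\<close>
  have "(b12 \<alpha> *s w 8) $ 3 = L \<alpha>' (w 1) (w 2) $ 3"
    by (simp only: h12)
  then have "c0 * (b1 * a0 - c0 * a1) = 0"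
    by (simp add: w_unfold L_nth defs)
  with det have c0: "c0 = 0" and nz: "a0 \<noteq> 0" "b1 \<noteq> 0"
    by auto
  have w10: "w 1 $ 0 = 0"
    using c0 defs by simp
  have w8_8: "w 8 $ 8 = a0 ^ 7 * b1"
    unfolding w_unfold L_nth w10 b16 defs by algebra
  have "b00 \<alpha> * w 8 $ 8 = L \<alpha>' (w 0) (w 0) $ 8"
    by (simp flip: h00)
  then have e00: "b00 \<alpha> * (a0 ^ 7 * b1) = b00 \<alpha>' * a0\<^sup>2 + b01 \<alpha>' * a0 * a1 + b11 \<alpha>' * a1\<^sup>2"
    unfolding w8_8 by (simp add: L_nth defs power2_eq_square algebra_simps)
  \<comment> \<open>Adding \<open>w 2 = [w 1, w 0]\<close> to \<open>[w 0, w 1]\<close> cancels all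
    antisymmetric terms; this is where the factor 2 at \<open>b11\<close> comes from.\<close>
  have "b01 \<alpha> * w 8 $ 8 = L \<alpha>' (w 0) (w 1) $ 8 + w 2 $ 8"
    by (simp flip: h01)
  then have e01: "b01 \<alpha> * (a0 ^ 7 * b1) = b01 \<alpha>' * a0 * b1 + 2 * b11 \<alpha>' * a1 * b1"
    unfolding w8_8 by (simp add: w2 L_nth defs w10 b16 algebra_simps)
  have "b11 \<alpha> * w 8 $ 8 = L \<alpha>' (w 1) (w 1) $ 8"
    by (simp flip: h11)
  then have e11: "b11 \<alpha> * (a0 ^ 7 * b1) = b11 \<alpha>' * b1\<^sup>2"
    unfolding w8_8 by (simp add: L_nth defs w10 power2_eq_square algebra_simps)
  have "b14 \<alpha> * w 8 $ 8 = L \<alpha>' (w 1) (w 4) $ 8"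
    by (simp flip: h14)
  then have e14: "b14 \<alpha> * (a0 ^ 7 * b1) = b14 \<alpha>' * a0 ^ 3 * b1\<^sup>2"
    unfolding w8_8 unfolding w2 w3 w4 L_nth w10 b16 defs by algebra
  show thesis
    by (rule that[OF nz e00 e01 e11 e14])
qed

text \<open>
  The images of \<open>e 0\<close> and \<open>e 1\<close> are \<open>a0 e\<^sub>0 + a1 e\<^sub>1\<close> and \<open>b1 e\<^sub>1 + b3 e\<^sub>3\<close>. The others are forced
  by \<open>[e\<^sub>i, e\<^sub>0] = e\<^sub>i\<^sub>+\<^sub>1\<close>, with brackets taken in \<open>L \<alpha>\<close> for \<open>b16 \<alpha> = 0\<close>.
\<close>

definition iso_map :: "ce_param \<Rightarrow> complex \<Rightarrow> complex \<Rightarrow> complex \<Rightarrow> complex \<Rightarrow> complex ^ 9 \<Rightarrow> complex ^ 9"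
  where "iso_map \<alpha> a0 a1 b1 b3 x =
    (x $ 0 * a0) *s e 0
    + (x $ 0 * a1 + x $ 1 * b1) *s e 1
    + (x $ 2 * a0 * b1) *s e 2
    + (x $ 1 * b3 + x $ 3 * a0 ^ 2 * b1) *s e 3
    + (x $ 2 * a0 * b3 + x $ 4 * a0 ^ 3 * b1) *s e 4
    + (x $ 3 * a0 ^ 2 * b3 + x $ 5 * a0 ^ 4 * b1) *s e 5
    + (x $ 4 * a0 ^ 3 * b3 + x $ 6 * a0 ^ 5 * b1) *s e 6
    + (x $ 5 * a0 ^ 4 * b3 + x $ 7 * a0 ^ 6 * b1) *s e 7
    + (x $ 2 * b11 \<alpha> * a1 * b1
       - x $ 3 * a0 * a1 * (b12 \<alpha> * b1 + b14 \<alpha> * b3)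
       - x $ 5 * a0 ^ 3 * a1 * b1 * b14 \<alpha>
       + x $ 6 * a0 ^ 5 * b3 + x $ 8 * a0 ^ 7 * b1) *s e 8"

lemma iso_map_nth:
  "iso_map \<alpha> a0 a1 b1 b3 x $ 0 = x $ 0 * a0"
  "iso_map \<alpha> a0 a1 b1 b3 x $ 1 = x $ 0 * a1 + x $ 1 * b1"
  "iso_map \<alpha> a0 a1 b1 b3 x $ 2 = x $ 2 * a0 * b1"
  "iso_map \<alpha> a0 a1 b1 b3 x $ 3 = x $ 1 * b3 + x $ 3 * a0 ^ 2 * b1"
  "iso_map \<alpha> a0 a1 b1 b3 x $ 4 = x $ 2 * a0 * b3 + x $ 4 * a0 ^ 3 * b1"
  "iso_map \<alpha> a0 a1 b1 b3 x $ 5 = x $ 3 * a0 ^ 2 * b3 + x $ 5 * a0 ^ 4 * b1"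
  "iso_map \<alpha> a0 a1 b1 b3 x $ 6 = x $ 4 * a0 ^ 3 * b3 + x $ 6 * a0 ^ 5 * b1"
  "iso_map \<alpha> a0 a1 b1 b3 x $ 7 = x $ 5 * a0 ^ 4 * b3 + x $ 7 * a0 ^ 6 * b1"
  "iso_map \<alpha> a0 a1 b1 b3 x $ 8 =
     x $ 2 * b11 \<alpha> * a1 * b1
     - x $ 3 * a0 * a1 * (b12 \<alpha> * b1 + b14 \<alpha> * b3)
     - x $ 5 * a0 ^ 3 * a1 * b1 * b14 \<alpha>
     + x $ 6 * a0 ^ 5 * b3 + x $ 8 * a0 ^ 7 * b1"
  by (simp_all add: iso_map_def e_def axis_def)

lemma linear_iso_map: "Vector_Spaces.linear (*s) (*s) (iso_map \<alpha> a0 a1 b1 b3)"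
  by unfold_locales (simp_all add: vec_eq_iff all_9 iso_map_nth algebra_simps)

lemma bij_iso_map:
  assumes "a0 \<noteq> 0" "b1 \<noteq> 0"
  shows "bij (iso_map \<alpha> a0 a1 b1 b3)"
proof -
  let ?f = "iso_map \<alpha> a0 a1 b1 b3"
  interpret f: Vector_Spaces.linear "(*s)" "(*s)" ?f
    by (rule linear_iso_map)
  \<comment> \<open>The coordinates form a triangular system with diagonal entries
    \<open>a0\<close>, \<open>b1\<close>, \<open>a0 * b1\<close>, ...,
    \<open>a0 ^ 7 * b1\<close>.\<close>
  have "x = 0" if "?f x = 0" for x
    using that assms by (auto simp: vec_eq_iff all_9 iso_map_nth)
  then have "inj ?f"
    by (simp add: f.inj_iff_eq_0)
  then show ?thesis
    using vec.linear_inj_imp_surj[OF linear_iso_map] by (simp add: bij_def)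
qed

text \<open>Coordinates 0 to 7 agree identically in the parameters; the equations matter only for
  coordinate 8. In \<open>e12\<close>, the terms with \<open>b3\<close> come equally from
  \<open>[e 1, e 4]\<close> and \<open>[e 3, e 2]\<close>.\<close>

lemma iso_map_L:
  assumes b16: "b16 \<alpha> = 0" "b16 \<alpha>' = 0"
    and e00: "b00 \<alpha> * (a0 ^ 7 * b1) = b00 \<alpha>' * a0\<^sup>2 + b01 \<alpha>' * a0 * a1 + b11 \<alpha>' * a1\<^sup>2"
    and e01: "b01 \<alpha> * (a0 ^ 7 * b1) = b01 \<alpha>' * a0 * b1 + 2 * b11 \<alpha>' * a1 * b1"
    and e11: "b11 \<alpha> * (a0 ^ 7 * b1) = b11 \<alpha>' * b1\<^sup>2"
    and e12: "b12 \<alpha> * (a0 ^ 7 * b1) = a0 * b12 \<alpha>' * b1\<^sup>2 + 2 * a0 * b14 \<alpha>' * b1 * b3"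
    and e14: "b14 \<alpha> * (a0 ^ 7 * b1) = b14 \<alpha>' * a0 ^ 3 * b1\<^sup>2"
  defines "f \<equiv> iso_map \<alpha>' a0 a1 b1 b3"
  shows "f (L \<alpha> x y) = L \<alpha>' (f x) (f y)"
proof -
  have nth_8: "f (L \<alpha> x y) $ 8 = L \<alpha>' (f x) (f y) $ 8"
    using e00 e01 e11 e12 e14
    unfolding f_def iso_map_nth L_nth b16 by algebra
  show ?thesis
    unfolding vec_eq_iff all_9
    by (intro conjI nth_8) (unfold f_def iso_map_nth L_nth, algebra+)
qed

text \<open>Squares satisfy \<open>[x, x] = q x *s e 8\<close> for the binary quadratic form
  \<open>q\<close> with coefficients \<open>b00\<close>, \<open>b01\<close>, \<open>b11\<close>. By
  \<open>e00\<close>, \<open>e01\<close> and \<open>e11\<close>, the form of \<alpha> times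
  \<open>a0 ^ 7 * b1\<close> is the form of \<alpha>' after a substitution of determinant
  \<open>a0 * b1\<close>, whose square multiplies the discriminant.\<close>

lemma parameter_equations_imp_invariant_eq:
  assumes "b14 \<alpha> \<noteq> 0" "b14 \<alpha>' \<noteq> 0" and nz: "a0 \<noteq> 0" "b1 \<noteq> 0"
    and e00: "b00 \<alpha> * (a0 ^ 7 * b1) = b00 \<alpha>' * a0\<^sup>2 + b01 \<alpha>' * a0 * a1 + b11 \<alpha>' * a1\<^sup>2"
    and e01: "b01 \<alpha> * (a0 ^ 7 * b1) = b01 \<alpha>' * a0 * b1 + 2 * b11 \<alpha>' * a1 * b1"
    and e11: "b11 \<alpha> * (a0 ^ 7 * b1) = b11 \<alpha>' * b1\<^sup>2"
    and e14: "b14 \<alpha> * (a0 ^ 7 * b1) = b14 \<alpha>' * a0 ^ 3 * b1\<^sup>2"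
  shows "(b11 \<alpha> / b14 \<alpha>) ^ 4 * (1 / disc \<alpha>) = (b11 \<alpha>' / b14 \<alpha>') ^ 4 * (1 / disc \<alpha>')"
proof -
  have "disc \<alpha> * (a0 ^ 7 * b1)\<^sup>2 =
      (b01 \<alpha> * (a0 ^ 7 * b1))\<^sup>2 - 4 * (b00 \<alpha> * (a0 ^ 7 * b1)) * (b11 \<alpha> * (a0 ^ 7 * b1))"
    unfolding disc_def by algebra
  also have "\<dots> = disc \<alpha>' * (a0 * b1)\<^sup>2"
    unfolding e00 e01 e11 disc_def by algebra
  finally have "(disc \<alpha> * a0 ^ 12 - disc \<alpha>') * (a0 * b1)\<^sup>2 = 0"
    by algebra
  then have disc: "disc \<alpha>' = disc \<alpha> * a0 ^ 12"
    using nz by simp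
  have "(b11 \<alpha>' * b14 \<alpha> - b11 \<alpha> * b14 \<alpha>' * a0 ^ 3) * (a0 ^ 7 * b1 ^ 2) = 0"
    using e11 e14 by algebra
  then have "b11 \<alpha>' * b14 \<alpha> = b11 \<alpha> * b14 \<alpha>' * a0 ^ 3"
    using nz by simp
  then have "b11 \<alpha>' / b14 \<alpha>' = b11 \<alpha> / b14 \<alpha> * a0 ^ 3"
    using assms(1,2) by (simp add: field_simps)
  then have "(b11 \<alpha>' / b14 \<alpha>') ^ 4 = (b11 \<alpha> / b14 \<alpha>) ^ 4 * a0 ^ 12"
    by (simp add: power_mult_distrib power_divide flip: power_mult)
  \<comment> \<open>The factors \<open>a0 ^ 12\<close> cancel; if the discriminants vanish, both
    sides are 0.\<close>
  with disc nz show ?thesis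
    by simp
qed

lemma invariant_eq_imp_L_isomorphic:
  assumes b16: "b16 \<alpha> = 0" "b16 \<alpha>' = 0"
    and b14: "b14 \<alpha> \<noteq> 0" "b14 \<alpha>' \<noteq> 0" and b11: "b11 \<alpha> \<noteq> 0" "b11 \<alpha>' \<noteq> 0"
    and inv: "(b11 \<alpha> / b14 \<alpha>) ^ 4 * (1 / disc \<alpha>) = (b11 \<alpha>' / b14 \<alpha>') ^ 4 * (1 / disc \<alpha>')"
  shows "L \<alpha> \<cong>\<^sub>L L \<alpha>'"
proof -
  \<comment> \<open>The equations \<open>e11\<close> and \<open>e14\<close> force
    \<open>a0 ^ 3\<close> to be this ratio.\<close>
  define r where "r = (b11 \<alpha>' / b14 \<alpha>') / (b11 \<alpha> / b14 \<alpha>)"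
  have r: "r \<noteq> 0" "b11 \<alpha>' / b14 \<alpha>' = b11 \<alpha> / b14 \<alpha> * r"
    using b11 b14 by (simp_all add: r_def)
  obtain a0 where a0: "a0 ^ 3 = r"
    using exists_complex_root[of 3 r] by auto
  with r have nz: "a0 \<noteq> 0"
    by auto
  have a0_12: "a0 ^ 12 = r ^ 4"
    by (simp flip: a0 power_mult)
  have disc: "disc \<alpha>' = disc \<alpha> * a0 ^ 12"
  \<comment> \<open>As \<open>b11\<close> and \<open>b14\<close> are nonzero, an invariant is 0 only
    through division by zero, so one discriminant vanishes iff the other does.\<close>
  proof (cases "disc \<alpha> = 0 \<or> disc \<alpha>' = 0")
    case True
    with inv b11 b14 show ?thesis
      by auto
  next
    case False
    with inv b11 b14 r show ?thesis
      by (simp add: r(2) a0_12 power_mult_distrib divide_simps mult_ac)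
  qed
  have b11b14: "b11 \<alpha>' * b14 \<alpha> = b11 \<alpha> * b14 \<alpha>' * a0 ^ 3"
    using r(2) b14 by (simp add: a0 field_simps)
  \<comment> \<open>The values \<open>b1\<close>, \<open>a1\<close> and \<open>b3\<close> are the
    solutions of \<open>e14\<close>, \<open>e01\<close> and \<open>e12\<close> after cancelling
    common factors.\<close>
  define b1 where "b1 = b14 \<alpha> / b14 \<alpha>' * a0 ^ 4"
  have b1: "b1 \<noteq> 0" "b14 \<alpha>' * b1 = b14 \<alpha> * a0 ^ 4"
    using b14 nz by (simp_all add: b1_def)
  define a1 where "a1 = (b01 \<alpha> * a0 ^ 7 - b01 \<alpha>' * a0) / (2 * b11 \<alpha>')"
  have a1: "2 * b11 \<alpha>' * a1 = b01 \<alpha> * a0 ^ 7 - b01 \<alpha>' * a0"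
    using b11 by (simp add: a1_def)
  define b3 where "b3 = (b12 \<alpha> * a0 ^ 6 - b12 \<alpha>' * b1) / (2 * b14 \<alpha>')"
  have b3: "2 * b14 \<alpha>' * b3 = b12 \<alpha> * a0 ^ 6 - b12 \<alpha>' * b1"
    using b14 by (simp add: b3_def)
  have "(b11 \<alpha> * a0 ^ 7 - b11 \<alpha>' * b1) * b14 \<alpha>' = 0"
    using b11b14 b1(2) by algebra
  then have b11': "b11 \<alpha>' * b1 = b11 \<alpha> * a0 ^ 7"
    using b14 by simp
  have e14: "b14 \<alpha> * (a0 ^ 7 * b1) = b14 \<alpha>' * a0 ^ 3 * b1\<^sup>2"
    using b1(2) by algebra
  have e11: "b11 \<alpha> * (a0 ^ 7 * b1) = b11 \<alpha>' * b1\<^sup>2"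
    using b11' by algebra
  have e01: "b01 \<alpha> * (a0 ^ 7 * b1) = b01 \<alpha>' * a0 * b1 + 2 * b11 \<alpha>' * a1 * b1"
    using a1 by algebra
  have e12: "b12 \<alpha> * (a0 ^ 7 * b1) = a0 * b12 \<alpha>' * b1\<^sup>2 + 2 * a0 * b14 \<alpha>' * b1 * b3"
    using b3 by algebra
  \<comment> \<open>Completing the square: the choice of \<open>a1\<close> turns
    \<open>2 * b11 \<alpha>' * a1 + b01 \<alpha>' * a0\<close> into
    \<open>b01 \<alpha> * a0 ^ 7\<close>, and the relation between the discriminants does the
    rest.\<close>
  have "4 * b11 \<alpha>' * (b00 \<alpha>' * a0\<^sup>2 + b01 \<alpha>' * a0 * a1 + b11 \<alpha>' * a1\<^sup>2) =
      4 * b00 \<alpha>' * b11 \<alpha>' * a0\<^sup>2 + 2 * b01 \<alpha>' * a0 * (2 * b11 \<alpha>' * a1) + (2 * b11 \<alpha>' * a1)\<^sup>2"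
    by algebra
  also have "\<dots> = b01 \<alpha> ^ 2 * a0 ^ 14 - disc \<alpha>' * a0\<^sup>2"
    unfolding a1 disc_def by algebra
  also have "\<dots> = 4 * b00 \<alpha> * (b11 \<alpha> * a0 ^ 7) * a0 ^ 7"
    unfolding disc unfolding disc_def by algebra
  also have "\<dots> = 4 * b11 \<alpha>' * (b00 \<alpha> * (a0 ^ 7 * b1))"
    unfolding b11'[symmetric] by algebra
  finally have e00: "b00 \<alpha> * (a0 ^ 7 * b1) = b00 \<alpha>' * a0\<^sup>2 + b01 \<alpha>' * a0 * a1 + b11 \<alpha>' * a1\<^sup>2"
    using b11 by simp
  show ?thesis
    unfolding leibniz_isomorphic_def
    using linear_iso_map bij_iso_map[OF nz b1(1)] iso_map_L[OF b16 e00 e01 e11 e12 e14] by blast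
qed

lemma L_isomorphic_iff_invariant_eq:
  assumes "L \<alpha> \<in> U5" "L \<alpha>' \<in> U5"
  shows "L \<alpha> \<cong>\<^sub>L L \<alpha>' \<longleftrightarrow>
    (b11 \<alpha> / b14 \<alpha>) ^ 4 * (1 / disc \<alpha>) = (b11 \<alpha>' / b14 \<alpha>') ^ 4 * (1 / disc \<alpha>')"
  using assms invariant_eq_imp_L_isomorphic parameter_equations_imp_invariant_eq
    L_isomorphic_imp_parameter_equations
  unfolding L_in_U5_iff by metis

theorem proposition3p17:
  shows
    "(\<forall>\<alpha> \<alpha>'. L \<alpha> \<in> U5 \<longrightarrow> L \<alpha>' \<in> U5 \<longrightarrow>
        (L \<alpha> \<cong>\<^sub>L L \<alpha>' \<longleftrightarrow>
          (b11 \<alpha> / b14 \<alpha>) ^ 4 * (1 / disc \<alpha>) = (b11 \<alpha>' / b14 \<alpha>') ^ 4 * (1 / disc \<alpha>')))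
     \<and> (\<forall>c::complex. \<exists>\<alpha>. L \<alpha> \<in> U5 \<and> (b11 \<alpha> / b14 \<alpha>) ^ 4 * (1 / disc \<alpha>) = c)
     \<and> (\<forall>c::complex. L (CE_param c 0 1 0 1 0) \<in> U5)
     \<and> (\<forall>A \<in> U5. \<exists>!c::complex. A \<cong>\<^sub>L L (CE_param c 0 1 0 1 0))"
proof (intro conjI allI impI ballI)
  let ?N = "\<lambda>c. CE_param c 0 1 0 1 0"
  have U5: "L (?N c) \<in> U5" for c
    by (simp add: L_in_U5_iff)
  \<comment> \<open>At \<open>c = 0\<close> both sides are the junk value 0, so the invariant is a bijection in \<open>c\<close>.\<close>
  have invariant: "(b11 (?N c) / b14 (?N c)) ^ 4 * (1 / disc (?N c)) = - 1 / (4 * c)" for c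
    by (simp add: disc_def)
  \<comment> \<open>The map sending \<open>c\<close> to \<open>- 1 / (4 * c)\<close> is its own
    inverse, also at 0. It gives both a witness for each value of the invariant and the unique
    parameter of each class.\<close>
  have iff: "- 1 / (4 * c) = d \<longleftrightarrow> c = - 1 / (4 * d)" for c d :: complex
    by (cases "c = 0"; cases "d = 0") (auto simp: field_simps)
  show "L (?N c) \<in> U5" for c
    by (rule U5)
  show "\<exists>\<alpha>. L \<alpha> \<in> U5 \<and> (b11 \<alpha> / b14 \<alpha>) ^ 4 * (1 / disc \<alpha>) = c" for c
    using U5 invariant iff by metis
  show "\<exists>!c. A \<cong>\<^sub>L L (?N c)" if A_U5: "A \<in> U5" for A
  proof -
    obtain \<alpha> where A: "A = L \<alpha>"
      using A_U5 by (auto simp: U5_def)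
    have "A \<cong>\<^sub>L L (?N c) \<longleftrightarrow> c = - 1 / (4 * ((b11 \<alpha> / b14 \<alpha>) ^ 4 * (1 / disc \<alpha>)))" for c
      using L_isomorphic_iff_invariant_eq[OF A_U5[unfolded A] U5[of c]]
      unfolding invariant A by (metis iff)
    then show ?thesis
      by simp
  qed
qed (rule L_isomorphic_iff_invariant_eq)

end
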